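(* The class of $\mathrm{M}$-saturated $\mathrm{LE}$-models has the Hennessy-Milner property; that is, for all $\mathrm{M}$-saturated $\mathrm{LE}$-models $\mathfrak{M}_1,\mathfrak{M}_2$ with underlying polarities $(A_1,X_1,I_1)$, $(A_2,X_2,I_2)$, and all $a_1\in A_1$, $x_1\in X_1$, $a_2\in A_2$, $x_2\in X_2$: (1) $\mathfrak{M}_1,a_1\rightsquigarrow_A\mathfrak{M}_2,a_2$ implies that there is a simulation $(S,T)$ from $\mathfrak{M}_1$ to $\mathfrak{M}_2$ with $a_1Sa_2$; and (2) $\mathfrak{M}_1,x_1\rightsquigarrow_X\mathfrak{M}_2,x_2$ implies that there is a simulation $(S,T)$ from $\mathfrak{M}_2$ to $\mathfrak{M}_1$ with $x_2Tx_1$.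
   Context: Language. Fix a countable set $\mathcal{V}$ of propositional variables. The set $\mathcal{L}$ of formulas is given by $\varphi ::= p\mid\bot\mid\top\mid\varphi\wedge\varphi\mid\varphi\vee\varphi\mid\Box\varphi\mid\Diamond\varphi$, $p\in\mathcal{V}$. Polarities. A polarity is $\mathfrak{P}=(A,X,I)$ with $A,X$ sets and $I\subseteq A\times X$. For $B\subseteq A$, $Y\subseteq X$: $B^\uparrow=\{x\in X\mid \forall b\in B,\ bIx\}$, $Y^\downarrow=\{a\in A\mid\forall y\in Y,\ aIy\}$. $B$ (resp. $Y$) is Galois-stable if $B^{\uparrow\downarrow}=B$ (resp. $Y^{\downarrow\uparrow}=Y$). A formal concept is a pair $c=([\![c]\!],(\![c]\!))$ with $[\![c]\!]\subseteq A$, $(\![c]\!)\subseteq X$, $[\![c]\!]^\uparrow=(\![c]\!)$, $(\![c]\!)^\downarrow=[\![c]\!]$. $\mathrm{LE}$-models. An $\mathrm{LE}$-frame is $(A,X,I,R_\Box,R_\Diamond)$ where $(A,X,I)$ is a polarity and $R_\Box\subseteq A\times X$, $R_\Diamond\subseteq X\times A$ are $I$-compatible: for all $a\in A$, $x\in X$, the sets $\{a'\mid a'R_\Box x\}$, $\{x'\mid aR_\Box x'\}$, $\{x'\mid x'R_\Diamond a\}$, $\{a'\mid xR_\Diamond a'\}$ are Galois-stable. An $\mathrm{LE}$-model $\mathfrak{M}$ is an $\mathrm{LE}$-frame with a valuation $V$ assigning to each $p\in\mathcal{V}$ a formal concept $V(p)=([\![V(p)]\!],(\![V(p)]\!))$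 of $(A,X,I)$. Satisfaction (for $a\in A$, $x\in X$): $a\Vdash p$ iff $a\in[\![V(p)]\!]$; $x\succ p$ iff $x\in(\![V(p)]\!)$; $a\Vdash\top$ always; $x\succ\top$ iff $\forall a\in A\, (aIx)$; $x\succ\bot$ always; $a\Vdash\bot$ iff $\forall x\in X\,(aIx)$; $a\Vdash\varphi\wedge\psi$ iff $a\Vdash\varphi$ and $a\Vdash\psi$; $x\succ\varphi\vee\psi$ iff $x\succ\varphi$ and $x\succ\psi$; $a\Vdash\Box\varphi$ iff $\forall x\in X\,(x\succ\varphi\Rightarrow aR_\Box x)$; $x\succ\Diamond\varphi$ iff $\forall a\in A\,(a\Vdash\varphi\Rightarrow xR_\Diamond a)$; for $\chi$ of the form $\varphi\wedge\psi$ or $\Box\varphi$: $x\succ\chi$ iff $\forall a\in A\,(a\Vdash\chi\Rightarrow aIx)$; for $\chi$ of the form $\varphi\vee\psi$ or $\Diamond\varphi$: $a\Vdash\chi$ iff $\forall x\in X\,(x\succ\chi\Rightarrow aIx)$. One writes $\mathfrak{M},a\Vdash\varphi$ and $\mathfrak{M},x\succ\varphi$. Modal comparison. $\mathfrak{M}_1,a_1\rightsquigarrow_A\mathfrak{M}_2,a_2$ means: for all $\varphi\in\mathcal{L}$, $\mathfrak{M}_1,a_1\Vdash\varphi$ implies $\mathfrak{M}_2,a_2\Vdash\varphi$. $\mathfrak{M}_1,x_1\rightsquigarrow_X\mathfrak{M}_2,x_2$ means: for all $\varphi\in\mathcal{L}$, $\mathfrak{M}_1,x_1\succ\varphi$ implies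 $\mathfrak{M}_2,x_2\succ\varphi$. Simulations. Superscript $c$ denotes the complement of a relation. A simulation from $\mathfrak{M}_1=(A_1,X_1,I_1,R_{\Box_1},R_{\Diamond_1},V_1)$ to $\mathfrak{M}_2=(A_2,X_2,I_2,R_{\Box_2},R_{\Diamond_2},V_2)$ is a pair $(S,T)$, $S\subseteq A_1\times A_2$, $T\subseteq X_1\times X_2$, such that for all $a_1,x_1,a_2,x_2$: 1. if $a_1Sa_2$ then for all $p\in\mathcal{V}$, $a_1\in[\![V_1(p)]\!]$ implies $a_2\in[\![V_2(p)]\!]$; 2. if $x_1Tx_2$ then for all $p\in\mathcal{V}$, $x_2\in(\![V_2(p)]\!)$ implies $x_1\in(\![V_1(p)]\!)$; 3. if $a_1Sa_2$ and $a_2I_2^cx_2$, there is $x_1\in X_1$ with $a_1I_1^cx_1$ and $x_1Tx_2$; 4. if $x_1Tx_2$ and $a_1I_1^cx_1$, there is $a_2\in A_2$ with $a_2I_2^cx_2$ and $a_1Sa_2$; 5. if $a_1Sa_2$ and $a_2R_{\Box_2}^cx_2$, there is $x_1\in X_1$ with $a_1R_{\Box_1}^cx_1$ and $x_1Tx_2$; 6. if $x_1Tx_2$ and $x_1R_{\Diamond_1}^ca_1$, there is $a_2\in A_2$ with $x_2R_{\Diamond_2}^ca_2$ and $a_1Sa_2$. $\mathrm{M}$-saturation. Let $\mathfrak{M}=(A,X,I,R_\Box,R_\Diamond,V)$ be an $\mathrm{LE}$-model, $A'\subseteq A$, $X'\subseteq X$, $\Sigma\subseteq\mathcal{L}$.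 $\Sigma$ is satisfiable in $A'$ (resp. $X'$) if there is a point $a\in A'$ (resp. $x\in X'$) with $\mathfrak{M},a\Vdash\varphi$ (resp. $\mathfrak{M},x\succ\varphi$) for all $\varphi\in\Sigma$; it is finitely satisfiable there if every finite subset of $\Sigma$ is satisfiable there. $\mathfrak{M}$ is $\mathrm{M}$-saturated (modally-saturated) if for all $\Sigma\subseteq\mathcal{L}$, $a\in A$, $x\in X$, and for each of the four sets $\{x'\mid aI^cx'\}$, $\{a'\mid a'I^cx\}$, $\{x'\mid aR_\Box^cx'\}$, $\{a'\mid xR_\Diamond^ca'\}$: if $\Sigma$ is finitely satisfiable in the set, then $\Sigma$ is satisfiable in it. *)

theory Defs
  imports "HOL-Library.Countable"
begin

datatype 'p fm =
    Var 'p
  | Bot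
  | Top
  | Conj "'p fm" "'p fm"
  | Disj "'p fm" "'p fm"
  | Box "'p fm"
  | Dia "'p fm"

text \<open>Structures are records with explicit carriers \<open>objs\<close> (the set \<open>A\<close>) and \<open>feats\<close>
  (the set \<open>X\<close>).\<close>

record ('a, 'x) polarity =
  objs :: "'a set"
  feats :: "'x set"
  inc :: "('a \<times> 'x) set"

record ('a, 'x) le_frame = "('a, 'x) polarity" +
  RBox :: "('a \<times> 'x) set"
  RDia :: "('x \<times> 'a) set"

record ('p, 'a, 'x) le_model = "('a, 'x) le_frame" +
  val :: "'p \<Rightarrow> 'a set \<times> 'x set"

definition is_polarity :: "('a, 'x, 'm) polarity_scheme \<Rightarrow> bool" where
  "is_polarity P \<longleftrightarrow> inc P \<subseteq> objs P \<times> feats P"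

definition up :: "('a, 'x, 'm) polarity_scheme \<Rightarrow> 'a set \<Rightarrow> 'x set" where
  "up P B = {x \<in> feats P. \<forall>b\<in>B. (b, x) \<in> inc P}"

definition down :: "('a, 'x, 'm) polarity_scheme \<Rightarrow> 'x set \<Rightarrow> 'a set" where
  "down P Y = {a \<in> objs P. \<forall>y\<in>Y. (a, y) \<in> inc P}"

definition stable_objs :: "('a, 'x, 'm) polarity_scheme \<Rightarrow> 'a set \<Rightarrow> bool" where
  "stable_objs P B \<longleftrightarrow> B \<subseteq> objs P \<and> down P (up P B) = B"

definition stable_feats :: "('a, 'x, 'm) polarity_scheme \<Rightarrow> 'x set \<Rightarrow> bool" where
  "stable_feats P Y \<longleftrightarrow> Y \<subseteq> feats P \<and> up P (down P Y) = Y"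

definition formal_concept :: "('a, 'x, 'm) polarity_scheme \<Rightarrow> 'a set \<times> 'x set \<Rightarrow> bool" where
  "formal_concept P c \<longleftrightarrow>
     fst c \<subseteq> objs P \<and> snd c \<subseteq> feats P \<and> up P (fst c) = snd c \<and> down P (snd c) = fst c"

definition is_le_frame :: "('a, 'x, 'm) le_frame_scheme \<Rightarrow> bool" where
  "is_le_frame F \<longleftrightarrow>
     is_polarity F \<and>
     RBox F \<subseteq> objs F \<times> feats F \<and>
     RDia F \<subseteq> feats F \<times> objs F \<and>
     (\<forall>x\<in>feats F. stable_objs F {a. (a, x) \<in> RBox F}) \<and>
     (\<forall>a\<in>objs F. stable_feats F {x. (a, x) \<in> RBox F}) \<and>
     (\<forall>a\<in>objs F. stable_feats F {x. (x, a) \<in> RDia F}) \<and>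
     (\<forall>x\<in>feats F. stable_objs F {a. (x, a) \<in> RDia F})"

definition is_le_model :: "('p, 'a, 'x) le_model \<Rightarrow> bool" where
  "is_le_model M \<longleftrightarrow> is_le_frame M \<and> (\<forall>p. formal_concept M (val M p))"

text \<open>\<open>satA M \<phi> a\<close> renders \<open>M, a \<tturnstile> \<phi>\<close> and \<open>satX M \<phi> x\<close> renders \<open>M, x \<succ> \<phi>\<close>; they are
  meaningful for \<open>a \<in> objs M\<close> and \<open>x \<in> feats M\<close> only.\<close>

function satA :: "('p, 'a, 'x) le_model \<Rightarrow> 'p fm \<Rightarrow> 'a \<Rightarrow> bool"
  and satX :: "('p, 'a, 'x) le_model \<Rightarrow> 'p fm \<Rightarrow> 'x \<Rightarrow> bool" where
  "satA M (Var p) a \<longleftrightarrow> a \<in> fst (val M p)"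
| "satA M Top a \<longleftrightarrow> True"
| "satA M Bot a \<longleftrightarrow> (\<forall>x\<in>feats M. (a, x) \<in> inc M)"
| "satA M (Conj \<phi> \<psi>) a \<longleftrightarrow> satA M \<phi> a \<and> satA M \<psi> a"
| "satA M (Disj \<phi> \<psi>) a \<longleftrightarrow> (\<forall>x\<in>feats M. satX M (Disj \<phi> \<psi>) x \<longrightarrow> (a, x) \<in> inc M)"
| "satA M (Box \<phi>) a \<longleftrightarrow> (\<forall>x\<in>feats M. satX M \<phi> x \<longrightarrow> (a, x) \<in> RBox M)"
| "satA M (Dia \<phi>) a \<longleftrightarrow> (\<forall>x\<in>feats M. satX M (Dia \<phi>) x \<longrightarrow> (a, x) \<in> inc M)"
| "satX M (Var p) x \<longleftrightarrow> x \<in> snd (val M p)"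
| "satX M Top x \<longleftrightarrow> (\<forall>a\<in>objs M. (a, x) \<in> inc M)"
| "satX M Bot x \<longleftrightarrow> True"
| "satX M (Conj \<phi> \<psi>) x \<longleftrightarrow> (\<forall>a\<in>objs M. satA M (Conj \<phi> \<psi>) a \<longrightarrow> (a, x) \<in> inc M)"
| "satX M (Disj \<phi> \<psi>) x \<longleftrightarrow> satX M \<phi> x \<and> satX M \<psi> x"
| "satX M (Box \<phi>) x \<longleftrightarrow> (\<forall>a\<in>objs M. satA M (Box \<phi>) a \<longrightarrow> (a, x) \<in> inc M)"
| "satX M (Dia \<phi>) x \<longleftrightarrow> (\<forall>a\<in>objs M. satA M \<phi> a \<longrightarrow> (x, a) \<in> RDia M)"
  by pat_completeness auto
termination
  by (relation "measure (\<lambda>s. case s of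
        Inl (M, \<phi>, a) \<Rightarrow> 2 * size \<phi> + (case \<phi> of Disj _ _ \<Rightarrow> 1 | Dia _ \<Rightarrow> 1 | _ \<Rightarrow> 0)
      | Inr (M, \<phi>, x) \<Rightarrow> 2 * size \<phi> + (case \<phi> of Conj _ _ \<Rightarrow> 1 | Box _ \<Rightarrow> 1 | _ \<Rightarrow> 0))")
     (auto split: fm.splits)

definition modal_le_A ::
    "('p, 'a, 'x) le_model \<Rightarrow> 'a \<Rightarrow> ('p, 'b, 'y) le_model \<Rightarrow> 'b \<Rightarrow> bool" where
  "modal_le_A M1 a1 M2 a2 \<longleftrightarrow> (\<forall>\<phi>. satA M1 \<phi> a1 \<longrightarrow> satA M2 \<phi> a2)"

definition modal_le_X ::
    "('p, 'a, 'x) le_model \<Rightarrow> 'x \<Rightarrow> ('p, 'b, 'y) le_model \<Rightarrow> 'y \<Rightarrow> bool" where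
  "modal_le_X M1 x1 M2 x2 \<longleftrightarrow> (\<forall>\<phi>. satX M1 \<phi> x1 \<longrightarrow> satX M2 \<phi> x2)"

text \<open>Complements of relations are taken relative to the carriers; hence the membership
  conditions on the points in the last four clauses.\<close>

definition simulation ::
    "('p, 'a, 'x) le_model \<Rightarrow> ('p, 'b, 'y) le_model \<Rightarrow> ('a \<times> 'b) set \<Rightarrow> ('x \<times> 'y) set \<Rightarrow> bool"
where
  "simulation M1 M2 S T \<longleftrightarrow>
     S \<subseteq> objs M1 \<times> objs M2 \<and>
     T \<subseteq> feats M1 \<times> feats M2 \<and>
     (\<forall>a1 a2. (a1, a2) \<in> S \<longrightarrow> (\<forall>p. a1 \<in> fst (val M1 p) \<longrightarrow> a2 \<in> fst (val M2 p))) \<and>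
     (\<forall>x1 x2. (x1, x2) \<in> T \<longrightarrow> (\<forall>p. x2 \<in> snd (val M2 p) \<longrightarrow> x1 \<in> snd (val M1 p))) \<and>
     (\<forall>a1 a2. \<forall>x2\<in>feats M2. (a1, a2) \<in> S \<and> (a2, x2) \<notin> inc M2 \<longrightarrow>
        (\<exists>x1\<in>feats M1. (a1, x1) \<notin> inc M1 \<and> (x1, x2) \<in> T)) \<and>
     (\<forall>x1 x2. \<forall>a1\<in>objs M1. (x1, x2) \<in> T \<and> (a1, x1) \<notin> inc M1 \<longrightarrow>
        (\<exists>a2\<in>objs M2. (a2, x2) \<notin> inc M2 \<and> (a1, a2) \<in> S)) \<and>
     (\<forall>a1 a2. \<forall>x2\<in>feats M2. (a1, a2) \<in> S \<and> (a2, x2) \<notin> RBox M2 \<longrightarrow>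
        (\<exists>x1\<in>feats M1. (a1, x1) \<notin> RBox M1 \<and> (x1, x2) \<in> T)) \<and>
     (\<forall>x1 x2. \<forall>a1\<in>objs M1. (x1, x2) \<in> T \<and> (x1, a1) \<notin> RDia M1 \<longrightarrow>
        (\<exists>a2\<in>objs M2. (x2, a2) \<notin> RDia M2 \<and> (a1, a2) \<in> S))"

definition satisfiable_in_A :: "('p, 'a, 'x) le_model \<Rightarrow> 'a set \<Rightarrow> 'p fm set \<Rightarrow> bool" where
  "satisfiable_in_A M A' \<Sigma> \<longleftrightarrow> (\<exists>a\<in>A'. \<forall>\<phi>\<in>\<Sigma>. satA M \<phi> a)"

definition satisfiable_in_X :: "('p, 'a, 'x) le_model \<Rightarrow> 'x set \<Rightarrow> 'p fm set \<Rightarrow> bool" where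
  "satisfiable_in_X M X' \<Sigma> \<longleftrightarrow> (\<exists>x\<in>X'. \<forall>\<phi>\<in>\<Sigma>. satX M \<phi> x)"

definition fin_satisfiable_in_A :: "('p, 'a, 'x) le_model \<Rightarrow> 'a set \<Rightarrow> 'p fm set \<Rightarrow> bool" where
  "fin_satisfiable_in_A M A' \<Sigma> \<longleftrightarrow> (\<forall>\<Gamma>\<subseteq>\<Sigma>. finite \<Gamma> \<longrightarrow> satisfiable_in_A M A' \<Gamma>)"

definition fin_satisfiable_in_X :: "('p, 'a, 'x) le_model \<Rightarrow> 'x set \<Rightarrow> 'p fm set \<Rightarrow> bool" where
  "fin_satisfiable_in_X M X' \<Sigma> \<longleftrightarrow> (\<forall>\<Gamma>\<subseteq>\<Sigma>. finite \<Gamma> \<longrightarrow> satisfiable_in_X M X' \<Gamma>)"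

definition M_saturated :: "('p, 'a, 'x) le_model \<Rightarrow> bool" where
  "M_saturated M \<longleftrightarrow>
     (\<forall>\<Sigma>. \<forall>a\<in>objs M. \<forall>x\<in>feats M.
        (\<forall>X'\<in>{{x' \<in> feats M. (a, x') \<notin> inc M}, {x' \<in> feats M. (a, x') \<notin> RBox M}}.
           fin_satisfiable_in_X M X' \<Sigma> \<longrightarrow> satisfiable_in_X M X' \<Sigma>) \<and>
        (\<forall>A'\<in>{{a' \<in> objs M. (a', x) \<notin> inc M}, {a' \<in> objs M. (x, a') \<notin> RDia M}}.
           fin_satisfiable_in_A M A' \<Sigma> \<longrightarrow> satisfiable_in_A M A' \<Sigma>))"

end

theory Submission
  imports Defs
begin

text \<open>Modal comparison is itself a simulation between saturated models: let \<open>S\<close> relate \<open>a1\<close> to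
  \<open>a2\<close> when every formula holding at \<open>a1\<close> holds at \<open>a2\<close>, and let \<open>T\<close> relate \<open>x1\<close> to \<open>x2\<close> when
  every formula refuted at \<open>x2\<close> is refuted at \<open>x1\<close> (where \<open>x\<close> refutes \<open>\<phi>\<close> if \<open>x \<succ> \<phi>\<close>).
  The clauses on atoms are immediate. For a back-and-forth clause, say \<open>a1 S a2\<close> and \<open>a2\<close> is not
  incident with \<open>x2\<close>, the wanted \<open>x1\<close> is a point not incident with \<open>a1\<close> that refutes the whole set
  \<open>\<Sigma>\<close> of formulas refuted at \<open>x2\<close>. Saturation of the first model reduces this to a finite part
  of \<open>\<Sigma>\<close>, that is, to one formula, the disjunction \<open>\<delta>\<close> of that part. Now \<open>x2\<close> witnesses that
  \<open>\<delta>\<close> fails at \<open>a2\<close>, hence \<open>\<delta>\<close> fails at \<open>a1\<close>, and a witness of this failure is the required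
  point. The clause for the box relation runs the same way with \<open>Box \<delta>\<close> in place of
  \<open>\<delta>\<close>; the two clauses that lead from features to objects are order dual, with finite
  conjunctions, \<open>Dia\<close> and saturation of the second model.

  The passage between failure at an object and a witnessing feature holds because the
  objects satisfying a formula and the features refuting it form a formal concept, each side
  determining the other (\<open>satA_iff\<close> and \<open>satX_iff\<close>); this is where compatibility of the
  relations with the polarity enters.\<close>

section \<open>Formulas denote formal concepts\<close>

text \<open>This is the form in which compatibility of the modal relations is applied: membership in a
  section of a relation is tested against the features incident with the whole section.\<close>

lemma stable_objsD:
  assumes "stable_objs P B" "a \<in> objs P"
    and "\<And>y. y \<in> feats P \<Longrightarrow> \<forall>b\<in>B. (b, y) \<in> inc P \<Longrightarrow> (a, y) \<in> inc P"
  shows "a \<in> B"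
proof -
  have "a \<in> down P (up P B)"
    using assms(2,3) by (auto simp: up_def down_def)
  then show ?thesis
    using assms(1) by (simp add: stable_objs_def)
qed

lemma stable_featsD:
  assumes "stable_feats P Y" "x \<in> feats P"
    and "\<And>b. b \<in> objs P \<Longrightarrow> \<forall>y\<in>Y. (b, y) \<in> inc P \<Longrightarrow> (b, x) \<in> inc P"
  shows "x \<in> Y"
proof -
  have "x \<in> up P (down P Y)"
    using assms(2,3) by (auto simp: up_def down_def)
  then show ?thesis
    using assms(1) by (simp add: stable_feats_def)
qed

text \<open>Both halves have to be proved together. For each connective one of the two equivalences is its
  satisfaction clause; the other says that the side given by its own clause is Galois-stable.
  For conjunction and disjunction this follows from stability of the immediate subformulas, for the
  modalities from stability of the sections of their relation, an intersection of which is the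
  extension in question.\<close>

lemma formula_concept:
  fixes M :: "('p, 'a, 'x) le_model"
  assumes M: "is_le_model M"
  shows "(\<forall>a\<in>objs M. satA M \<phi> a \<longleftrightarrow> (\<forall>x\<in>feats M. satX M \<phi> x \<longrightarrow> (a, x) \<in> inc M)) \<and>
         (\<forall>x\<in>feats M. satX M \<phi> x \<longleftrightarrow> (\<forall>a\<in>objs M. satA M \<phi> a \<longrightarrow> (a, x) \<in> inc M))"
proof (induction \<phi>)
  case (Var p)
  have "formal_concept M (val M p)"
    using M by (simp add: is_le_model_def)
  then have sub: "fst (val M p) \<subseteq> objs M" "snd (val M p) \<subseteq> feats M"
    and eq: "fst (val M p) = down M (snd (val M p))" "snd (val M p) = up M (fst (val M p))"
    by (simp_all add: formal_concept_def)
  have "\<forall>a\<in>objs M. a \<in> fst (val M p) \<longleftrightarrow>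
      (\<forall>x\<in>feats M. x \<in> snd (val M p) \<longrightarrow> (a, x) \<in> inc M)"
    by (subst eq(1)) (use sub in \<open>auto simp: down_def\<close>)
  moreover have "\<forall>x\<in>feats M. x \<in> snd (val M p) \<longleftrightarrow>
      (\<forall>a\<in>objs M. a \<in> fst (val M p) \<longrightarrow> (a, x) \<in> inc M)"
    by (subst eq(2)) (use sub in \<open>auto simp: up_def\<close>)
  ultimately show ?case
    by (simp only: satA.simps satX.simps)
next
  case (Conj \<phi> \<psi>)
  have "satA M (Conj \<phi> \<psi>) a"
    if a: "a \<in> objs M" and inc: "\<forall>y\<in>feats M. satX M (Conj \<phi> \<psi>) y \<longrightarrow> (a, y) \<in> inc M" for a
  proof -
    have "satX M (Conj \<phi> \<psi>) y" if "y \<in> feats M" "satX M \<phi> y \<or> satX M \<psi> y" for y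
      using that Conj.IH unfolding satX.simps satA.simps by metis
    then have "satA M \<phi> a" "satA M \<psi> a"
      using Conj.IH a inc by metis+
    then show ?thesis by simp
  qed
  then show ?case unfolding satX.simps by metis
next
  case (Disj \<phi> \<psi>)
  have "satX M (Disj \<phi> \<psi>) x"
    if x: "x \<in> feats M" and inc: "\<forall>b\<in>objs M. satA M (Disj \<phi> \<psi>) b \<longrightarrow> (b, x) \<in> inc M" for x
  proof -
    have "satA M (Disj \<phi> \<psi>) b" if "b \<in> objs M" "satA M \<phi> b \<or> satA M \<psi> b" for b
      using that Disj.IH unfolding satX.simps satA.simps by metis
    then have "satX M \<phi> x" "satX M \<psi> x"
      using Disj.IH x inc by metis+
    then show ?thesis by simp
  qed
  then show ?case unfolding satA.simps by metis
next
  case (Box \<phi>)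
  have "satA M (Box \<phi>) a"
    if a: "a \<in> objs M" and inc: "\<forall>y\<in>feats M. satX M (Box \<phi>) y \<longrightarrow> (a, y) \<in> inc M" for a
  proof -
    have "a \<in> {a'. (a', x) \<in> RBox M}" if x: "x \<in> feats M" "satX M \<phi> x" for x
    proof (rule stable_objsD[OF _ a])
      show "stable_objs M {a'. (a', x) \<in> RBox M}"
        using M x by (simp add: is_le_model_def is_le_frame_def)
      fix y assume "y \<in> feats M" "\<forall>b\<in>{a'. (a', x) \<in> RBox M}. (b, y) \<in> inc M"
      moreover from this have "satX M (Box \<phi>) y"
        using x by auto
      ultimately show "(a, y) \<in> inc M"
        using inc by blast
    qed
    then show ?thesis by simp
  qed
  then show ?case unfolding satX.simps by metis
next
  case (Dia \<phi>)
  have "satX M (Dia \<phi>) x"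
    if x: "x \<in> feats M" and inc: "\<forall>b\<in>objs M. satA M (Dia \<phi>) b \<longrightarrow> (b, x) \<in> inc M" for x
  proof -
    have "x \<in> {x'. (x', a) \<in> RDia M}" if a: "a \<in> objs M" "satA M \<phi> a" for a
    proof (rule stable_featsD[OF _ x])
      show "stable_feats M {x'. (x', a) \<in> RDia M}"
        using M a by (simp add: is_le_model_def is_le_frame_def)
      fix b assume "b \<in> objs M" "\<forall>y\<in>{x'. (x', a) \<in> RDia M}. (b, y) \<in> inc M"
      moreover from this have "satA M (Dia \<phi>) b"
        using a by auto
      ultimately show "(b, x) \<in> inc M"
        using inc by blast
    qed
    then show ?thesis by simp
  qed
  then show ?case unfolding satA.simps by metis
qed auto

lemma satA_iff:
  assumes "is_le_model M" "a \<in> objs M"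
  shows "satA M \<phi> a \<longleftrightarrow> (\<forall>x\<in>feats M. satX M \<phi> x \<longrightarrow> (a, x) \<in> inc M)"
  using formula_concept[OF assms(1)] assms(2) by blast

lemma satX_iff:
  assumes "is_le_model M" "x \<in> feats M"
  shows "satX M \<phi> x \<longleftrightarrow> (\<forall>a\<in>objs M. satA M \<phi> a \<longrightarrow> (a, x) \<in> inc M)"
  using formula_concept[OF assms(1)] assms(2) by blast

section \<open>Saturation through finite conjunctions and disjunctions\<close>

lemma satA_big_Conj: "satA M (foldr Conj \<phi>s Top) a \<longleftrightarrow> (\<forall>\<phi>\<in>set \<phi>s. satA M \<phi> a)"
  by (induction \<phi>s) auto

lemma satX_big_Disj: "satX M (foldr Disj \<phi>s Bot) x \<longleftrightarrow> (\<forall>\<phi>\<in>set \<phi>s. satX M \<phi> x)"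
  by (induction \<phi>s) auto

text \<open>Saturation in the form used below: finite sets of formulas are replaced by single formulas.
  Clauses of \<open>M_saturated\<close> speak of an object and a feature at once, so the argument needs some
  feature to exist; the empty disjunction provides one.\<close>

lemma saturated_feats:
  assumes "M_saturated M" "a \<in> objs M" and R: "R = inc M \<or> R = RBox M"
    and ex: "\<And>\<phi>s. set \<phi>s \<subseteq> \<Sigma> \<Longrightarrow> \<exists>x\<in>feats M. (a, x) \<notin> R \<and> satX M (foldr Disj \<phi>s Bot) x"
  shows "\<exists>x\<in>feats M. (a, x) \<notin> R \<and> (\<forall>\<phi>\<in>\<Sigma>. satX M \<phi> x)"
proof -
  let ?X = "{x \<in> feats M. (a, x) \<notin> R}"
  obtain x0 where "x0 \<in> feats M"
    using ex[of "[]"] by auto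
  moreover have "fin_satisfiable_in_X M ?X \<Sigma>"
    unfolding fin_satisfiable_in_X_def satisfiable_in_X_def
  proof (intro allI impI)
    fix \<Gamma> assume "\<Gamma> \<subseteq> \<Sigma>" "finite \<Gamma>"
    moreover from this(2) obtain \<phi>s where "set \<phi>s = \<Gamma>"
      using finite_list by blast
    ultimately show "\<exists>x\<in>?X. \<forall>\<phi>\<in>\<Gamma>. satX M \<phi> x"
      using ex[of \<phi>s] unfolding satX_big_Disj by blast
  qed
  ultimately have "satisfiable_in_X M ?X \<Sigma>"
    using assms(1,2) R unfolding M_saturated_def by blast
  then show ?thesis
    by (auto simp: satisfiable_in_X_def)
qed

text \<open>The converse of \<open>RDia\<close> gives both relations the orientation of \<open>inc\<close>, so that one
  statement serves the incidence clause and the diamond clause.\<close>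

lemma saturated_objs:
  assumes "M_saturated M" "x \<in> feats M" and R: "R = inc M \<or> R = (RDia M)\<inverse>"
    and ex: "\<And>\<phi>s. set \<phi>s \<subseteq> \<Sigma> \<Longrightarrow> \<exists>a\<in>objs M. (a, x) \<notin> R \<and> satA M (foldr Conj \<phi>s Top) a"
  shows "\<exists>a\<in>objs M. (a, x) \<notin> R \<and> (\<forall>\<phi>\<in>\<Sigma>. satA M \<phi> a)"
proof -
  let ?A = "{a \<in> objs M. (a, x) \<notin> R}"
  obtain a0 where "a0 \<in> objs M"
    using ex[of "[]"] by auto
  moreover have "fin_satisfiable_in_A M ?A \<Sigma>"
    unfolding fin_satisfiable_in_A_def satisfiable_in_A_def
  proof (intro allI impI)
    fix \<Gamma> assume "\<Gamma> \<subseteq> \<Sigma>" "finite \<Gamma>"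
    moreover from this(2) obtain \<phi>s where "set \<phi>s = \<Gamma>"
      using finite_list by blast
    ultimately show "\<exists>a\<in>?A. \<forall>\<phi>\<in>\<Gamma>. satA M \<phi> a"
      using ex[of \<phi>s] unfolding satA_big_Conj by blast
  qed
  moreover have "?A \<in> {{a' \<in> objs M. (a', x) \<notin> inc M}, {a' \<in> objs M. (x, a') \<notin> RDia M}}"
    using R by auto
  ultimately have "satisfiable_in_A M ?A \<Sigma>"
    using assms(1,2) unfolding M_saturated_def by blast
  then show ?thesis
    by (auto simp: satisfiable_in_A_def)
qed

section \<open>Modal comparison as a simulation\<close>

text \<open>The comparison on features is reversed: a simulation transports truth forward along \<open>S\<close> and
  refutation backward along \<open>T\<close>. Clauses leading from \<open>S\<close> to \<open>T\<close> look for a feature of the first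
  model, those leading from \<open>T\<close> to \<open>S\<close> for an object of the second, so each model
  contributes one half of its saturation.\<close>

lemma modal_comparison_simulation:
  fixes M1 :: "('p, 'a, 'x) le_model" and M2 :: "('p, 'b, 'y) le_model"
  assumes M1: "is_le_model M1" "M_saturated M1" and M2: "is_le_model M2" "M_saturated M2"
  shows "simulation M1 M2
           {(a1, a2). a1 \<in> objs M1 \<and> a2 \<in> objs M2 \<and> modal_le_A M1 a1 M2 a2}
           {(x1, x2). x1 \<in> feats M1 \<and> x2 \<in> feats M2 \<and> modal_le_X M2 x2 M1 x1}"
    (is "simulation M1 M2 ?S ?T")
proof -
  have feat: "\<exists>x1\<in>feats M1. (a1, x1) \<notin> R \<and> (x1, x2) \<in> ?T"
    if R: "R = inc M1 \<or> R = RBox M1" and "a1 \<in> objs M1" "x2 \<in> feats M2"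
      and ex: "\<And>\<delta>. satX M2 \<delta> x2 \<Longrightarrow> \<exists>x1\<in>feats M1. (a1, x1) \<notin> R \<and> satX M1 \<delta> x1"
    for R a1 x2
  proof -
    have "\<exists>x1\<in>feats M1. (a1, x1) \<notin> R \<and> (\<forall>\<phi>\<in>{\<phi>. satX M2 \<phi> x2}. satX M1 \<phi> x1)"
      by (rule saturated_feats[OF M1(2) \<open>a1 \<in> objs M1\<close> R], rule ex) (auto simp: satX_big_Disj)
    then show ?thesis
      using \<open>x2 \<in> feats M2\<close> by (auto simp: modal_le_X_def)
  qed
  have obj: "\<exists>a2\<in>objs M2. (a2, x2) \<notin> R \<and> (a1, a2) \<in> ?S"
    if R: "R = inc M2 \<or> R = (RDia M2)\<inverse>" and "a1 \<in> objs M1" "x2 \<in> feats M2"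
      and ex: "\<And>\<gamma>. satA M1 \<gamma> a1 \<Longrightarrow> \<exists>a2\<in>objs M2. (a2, x2) \<notin> R \<and> satA M2 \<gamma> a2"
    for R a1 x2
  proof -
    have "\<exists>a2\<in>objs M2. (a2, x2) \<notin> R \<and> (\<forall>\<phi>\<in>{\<phi>. satA M1 \<phi> a1}. satA M2 \<phi> a2)"
      by (rule saturated_objs[OF M2(2) \<open>x2 \<in> feats M2\<close> R], rule ex) (auto simp: satA_big_Conj)
    then show ?thesis
      using \<open>a1 \<in> objs M1\<close> by (auto simp: modal_le_A_def)
  qed
  have inc_back: "\<exists>x1\<in>feats M1. (a1, x1) \<notin> inc M1 \<and> (x1, x2) \<in> ?T"
    if S: "(a1, a2) \<in> ?S" and x2: "x2 \<in> feats M2" and not_inc: "(a2, x2) \<notin> inc M2" for a1 a2 x2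
  proof (rule feat)
    fix \<delta> assume "satX M2 \<delta> x2"
    then have "\<not> satA M2 \<delta> a2"
      using S x2 not_inc satA_iff[OF M2(1), of a2 \<delta>] by blast
    then have "\<not> satA M1 \<delta> a1"
      using S by (auto simp: modal_le_A_def)
    then show "\<exists>x1\<in>feats M1. (a1, x1) \<notin> inc M1 \<and> satX M1 \<delta> x1"
      using S satA_iff[OF M1(1), of a1 \<delta>] by blast
  qed (use S x2 in auto)
  have inc_forth: "\<exists>a2\<in>objs M2. (a2, x2) \<notin> inc M2 \<and> (a1, a2) \<in> ?S"
    if T: "(x1, x2) \<in> ?T" and a1: "a1 \<in> objs M1" and not_inc: "(a1, x1) \<notin> inc M1" for x1 x2 a1
  proof (rule obj)
    fix \<gamma> assume "satA M1 \<gamma> a1"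
    then have "\<not> satX M1 \<gamma> x1"
      using T a1 not_inc satX_iff[OF M1(1), of x1 \<gamma>] by blast
    then have "\<not> satX M2 \<gamma> x2"
      using T by (auto simp: modal_le_X_def)
    then show "\<exists>a2\<in>objs M2. (a2, x2) \<notin> inc M2 \<and> satA M2 \<gamma> a2"
      using T satX_iff[OF M2(1), of x2 \<gamma>] by blast
  qed (use T a1 in auto)
  have box_back: "\<exists>x1\<in>feats M1. (a1, x1) \<notin> RBox M1 \<and> (x1, x2) \<in> ?T"
    if S: "(a1, a2) \<in> ?S" and x2: "x2 \<in> feats M2" and not_R: "(a2, x2) \<notin> RBox M2" for a1 a2 x2
  proof (rule feat)
    fix \<delta> assume "satX M2 \<delta> x2"
    then have "\<not> satA M2 (Box \<delta>) a2"
      using x2 not_R by auto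
    then have "\<not> satA M1 (Box \<delta>) a1"
      using S unfolding modal_le_A_def by blast
    then show "\<exists>x1\<in>feats M1. (a1, x1) \<notin> RBox M1 \<and> satX M1 \<delta> x1"
      by auto
  qed (use S x2 in auto)
  have dia_forth: "\<exists>a2\<in>objs M2. (x2, a2) \<notin> RDia M2 \<and> (a1, a2) \<in> ?S"
    if T: "(x1, x2) \<in> ?T" and a1: "a1 \<in> objs M1" and not_R: "(x1, a1) \<notin> RDia M1" for x1 x2 a1
  proof -
    have "\<exists>a2\<in>objs M2. (a2, x2) \<notin> (RDia M2)\<inverse> \<and> (a1, a2) \<in> ?S"
    proof (rule obj)
      fix \<gamma> assume "satA M1 \<gamma> a1"
      then have "\<not> satX M1 (Dia \<gamma>) x1"
        using a1 not_R by auto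
      then have "\<not> satX M2 (Dia \<gamma>) x2"
        using T unfolding modal_le_X_def by blast
      then show "\<exists>a2\<in>objs M2. (a2, x2) \<notin> (RDia M2)\<inverse> \<and> satA M2 \<gamma> a2"
        by auto
    qed (use T a1 in auto)
    then show ?thesis by simp
  qed
  have atom_A: "a2 \<in> fst (val M2 p)" if "(a1, a2) \<in> ?S" "a1 \<in> fst (val M1 p)" for a1 a2 p
    using that unfolding modal_le_A_def by (auto dest: spec[of _ "Var p"])
  have atom_X: "x1 \<in> snd (val M1 p)" if "(x1, x2) \<in> ?T" "x2 \<in> snd (val M2 p)" for x1 x2 p
    using that unfolding modal_le_X_def by (auto dest: spec[of _ "Var p"])
  have "?S \<subseteq> objs M1 \<times> objs M2" "?T \<subseteq> feats M1 \<times> feats M2"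
    by auto
  then show ?thesis
    unfolding simulation_def
    by (intro conjI allI ballI impI; (elim conjE)?)
      (assumption | rule atom_A atom_X inc_back inc_forth box_back dia_forth; assumption)+
qed

text \<open>The second half of the theorem is the same simulation with the models exchanged, since \<open>T\<close> runs
  against the modal comparison of features.\<close>

theorem theorem4p3:
  fixes M1 :: "('p::countable, 'a, 'x) le_model"
    and M2 :: "('p, 'b, 'y) le_model"
  assumes "is_le_model M1" and "M_saturated M1"
    and "is_le_model M2" and "M_saturated M2"
  shows "(\<forall>a1\<in>objs M1. \<forall>a2\<in>objs M2. modal_le_A M1 a1 M2 a2 \<longrightarrow>
            (\<exists>S T. simulation M1 M2 S T \<and> (a1, a2) \<in> S)) \<and>
         (\<forall>x1\<in>feats M1. \<forall>x2\<in>feats M2. modal_le_X M1 x1 M2 x2 \<longrightarrow>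
            (\<exists>S T. simulation M2 M1 S T \<and> (x2, x1) \<in> T))"
proof (intro conjI ballI impI)
  fix a1 a2 assume "a1 \<in> objs M1" "a2 \<in> objs M2" "modal_le_A M1 a1 M2 a2"
  then have "(a1, a2) \<in> {(a1, a2). a1 \<in> objs M1 \<and> a2 \<in> objs M2 \<and> modal_le_A M1 a1 M2 a2}"
    by simp
  with modal_comparison_simulation[OF assms]
  show "\<exists>S T. simulation M1 M2 S T \<and> (a1, a2) \<in> S"
    by (intro exI conjI)
next
  fix x1 x2 assume "x1 \<in> feats M1" "x2 \<in> feats M2" "modal_le_X M1 x1 M2 x2"
  then have "(x2, x1) \<in> {(x2, x1). x2 \<in> feats M2 \<and> x1 \<in> feats M1 \<and> modal_le_X M1 x1 M2 x2}"
    by simp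
  with modal_comparison_simulation[OF assms(3,4) assms(1,2)]
  show "\<exists>S T. simulation M2 M1 S T \<and> (x2, x1) \<in> T"
    by (intro exI conjI)
qed

end
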